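(* Consider the damped Hamiltonian system $\dot{x}=S(x)\nabla H(x)-D(t)x$ on $\mathbb{R}^N$, where $S(x)\in\mathbb{R}^{N\times N}$ is skew-symmetric and depends continuously on $x$, $H:\mathbb{R}^N\to\mathbb{R}$ is continuously differentiable, and $D(t)\in\mathbb{R}^{N\times N}$ is a diagonal matrix depending continuously on $t$. Let $c_1,\dots,c_s$ be distinct real numbers whose associated weights $b_i$ are all nonzero, and suppose that the collocation points are symmetric, i.e. $c_{s+1-i}=1-c_i$ for all $i=1,\dots,s$. Then the exponential energy-preserving collocation method with nodes $c_1,\dots,c_s$ is symmetric: for all $t_0\in\mathbb{R}$, $h\neq0$ and $x_0,x_1\in\mathbb{R}^N$, $x_1$ is a numerical solution obtained from $x_0$ by one step of the method starting at time $t_0$ with step size $h$ if and only if $x_0$ is a numerical solution obtained from $x_1$ by one step of the method starting at time $t_0+h$ with step size $-h$.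
   Context: Exponential energy-preserving collocation method. Given distinct real numbers $c_1,\dots,c_s$ (usually $0\le c_i\le 1$), put $$\ell_i(\tau)=\prod_{j=1,\,j\ne i}^{s}\frac{\tau-c_j}{c_i-c_j},\qquad b_i=\int_0^1\ell_i(\tau)\,\mathrm{d}\tau,\qquad A_{\tau,\sigma}=\sum_{i=1}^{s}\frac{1}{b_i}\Big(\int_0^{\tau}\ell_i(\alpha)\,\mathrm{d}\alpha\Big)\ell_i(\sigma),$$ where all $b_i$ are assumed nonzero. Let $f(x)=S(x)\nabla H(x)$. For a starting time $t_0$ and a step size $h\ne0$, let $$Y(t)=\int_{t_0+h/2}^{t}D(\tau)\,\mathrm{d}\tau,\qquad Y_\tau=Y(t_0+\tau h)\quad(\tau\in[0,1]);$$ these are diagonal matrices and $e^{Y_\tau}$ is the matrix exponential. One step of the method is defined implicitly: $x_1$ is a numerical solution obtained from $x_0$ by one step starting at time $t_0$ with step size $h$ if there is a continuous family of stages $X_\tau\in\mathbb{R}^N$, $\tau\in[0,1]$, such that $$X_\tau=e^{-Y_\tau}\Big(e^{Y_0}x_0+h\int_0^1A_{\tau,\sigma}\,f\big(e^{Y_\sigma}X_\sigma\big)\,\mathrm{d}\sigma\Big)\quad(\tau\in[0,1]),\qquad x_1=e^{-Y_1}\Big(e^{Y_0}x_0+h\int_0^1 f\big(e^{Y_\sigma}X_\sigma\big)\,\mathrm{d}\sigma\Big).$$ A one-step method is called symmetric if it is unchanged under exchanging $(t_0,x_0)\leftrightarrow(t_1,x_1)$, where $t_1=t_0+h$, and replacing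 $h$ by $-h$. *)

theory Defs
  imports "HOL-Analysis.Analysis"
begin

text \<open>The type \<open>real ^ 'n ^ 'n\<close> carries componentwise multiplication, so neither \<open>(^)\<close> nor
  the library's \<^term>\<open>exp\<close> gives the matrix operation; both are introduced here for
  the matrix product \<open>(**)\<close>.\<close>

primrec matrix_power :: "real ^ 'n ^ 'n \<Rightarrow> nat \<Rightarrow> real ^ 'n ^ 'n" where
  "matrix_power M 0 = mat 1"
| "matrix_power M (Suc k) = M ** matrix_power M k"

definition matrix_exp :: "real ^ 'n ^ 'n \<Rightarrow> real ^ 'n ^ 'n" where
  "matrix_exp M = (\<Sum>k. (1 / fact k) *\<^sub>R matrix_power M k)"

definition diagonal_matrix :: "real ^ 'n ^ 'n \<Rightarrow> bool" where
  "diagonal_matrix M \<longleftrightarrow> (\<forall>i j. i \<noteq> j \<longrightarrow> M $ i $ j = 0)"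

definition skew_symmetric :: "real ^ 'n ^ 'n \<Rightarrow> bool" where
  "skew_symmetric M \<longleftrightarrow> transpose M = - M"

definition gradient :: "(real ^ 'n \<Rightarrow> real) \<Rightarrow> real ^ 'n \<Rightarrow> real ^ 'n" where
  "gradient H x = (THE g. GDERIV H x :> g)"

definition continuously_differentiable :: "(real ^ 'n \<Rightarrow> real) \<Rightarrow> bool" where
  "continuously_differentiable H \<longleftrightarrow>
     (\<forall>x. H differentiable (at x)) \<and> continuous_on UNIV (gradient H)"

text \<open>Nodes are \<open>c 1, \<dots>, c s\<close>; other values of \<open>c\<close> are irrelevant.
  Integrals are the oriented interval integrals \<open>LBINT x=a..b\<close>, which change sign when the
  end points are swapped; this matters in \<open>damping_int\<close>, where \<open>t\<close> may
  be smaller than \<open>t0 + h/2\<close>.\<close>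

definition lagrange :: "nat \<Rightarrow> (nat \<Rightarrow> real) \<Rightarrow> nat \<Rightarrow> real \<Rightarrow> real" where
  "lagrange s c i \<tau> = (\<Prod>j\<in>{1..s} - {i}. (\<tau> - c j) / (c i - c j))"

definition weight :: "nat \<Rightarrow> (nat \<Rightarrow> real) \<Rightarrow> nat \<Rightarrow> real" where
  "weight s c i = (LBINT \<tau>=0..1. lagrange s c i \<tau>)"

definition coeffA :: "nat \<Rightarrow> (nat \<Rightarrow> real) \<Rightarrow> real \<Rightarrow> real \<Rightarrow> real" where
  "coeffA s c \<tau> \<sigma> =
     (\<Sum>i=1..s. 1 / weight s c i * (LBINT \<alpha>=0..ereal \<tau>. lagrange s c i \<alpha>) * lagrange s c i \<sigma>)"

definition damping_int :: "(real \<Rightarrow> real ^ 'n ^ 'n) \<Rightarrow> real \<Rightarrow> real \<Rightarrow> real \<Rightarrow> real ^ 'n ^ 'n" where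
  "damping_int D t0 h t = (LBINT \<tau>=ereal (t0 + h / 2)..ereal t. D \<tau>)"

text \<open>One step, for \<open>x' = S x \<nabla>H x - D t x\<close>, from \<open>(t0, x0)\<close> with step size \<open>h\<close>. The scheme is
  implicit, so it is a relation between \<open>x0\<close> and \<open>x1\<close>.\<close>

definition eepc_step ::
  "(real ^ 'n \<Rightarrow> real ^ 'n ^ 'n) \<Rightarrow> (real ^ 'n \<Rightarrow> real) \<Rightarrow> (real \<Rightarrow> real ^ 'n ^ 'n) \<Rightarrow>
   nat \<Rightarrow> (nat \<Rightarrow> real) \<Rightarrow> real \<Rightarrow> real \<Rightarrow> real ^ 'n \<Rightarrow> real ^ 'n \<Rightarrow> bool" where
  "eepc_step S H D s c t0 h x0 x1 \<longleftrightarrow>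
     (let f = (\<lambda>x. S x *v gradient H x);
          Y = (\<lambda>\<tau>. damping_int D t0 h (t0 + \<tau> * h))
      in \<exists>X :: real \<Rightarrow> real ^ 'n.
           continuous_on {0..1} X \<and>
           (\<forall>\<tau>\<in>{0..1}. X \<tau> = matrix_exp (- Y \<tau>) *v
              (matrix_exp (Y 0) *v x0 +
               h *\<^sub>R (LBINT \<sigma>=0..1. coeffA s c \<tau> \<sigma> *\<^sub>R f (matrix_exp (Y \<sigma>) *v X \<sigma>)))) \<and>
           x1 = matrix_exp (- Y 1) *v
              (matrix_exp (Y 0) *v x0 +
               h *\<^sub>R (LBINT \<sigma>=0..1. f (matrix_exp (Y \<sigma>) *v X \<sigma>))))"

definition symmetric_method :: "(real \<Rightarrow> real \<Rightarrow> 'a \<Rightarrow> 'a \<Rightarrow> bool) \<Rightarrow> bool" where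
  "symmetric_method \<Phi> \<longleftrightarrow>
     (\<forall>t0 h x0 x1. h \<noteq> 0 \<longrightarrow> (\<Phi> t0 h x0 x1 \<longleftrightarrow> \<Phi> (t0 + h) (- h) x1 x0))"

end

theory Submission
  imports Defs "HOL-Computational_Algebra.Polynomial"
begin

text \<open>Reversing time, \<open>\<tau> \<mapsto> 1 - \<tau>\<close>, leaves \<open>damping_int\<close> unchanged because its base point
  \<open>t0 + h/2\<close> is the midpoint of the step. Hence \<open>X (1 - \<tau>)\<close> are stages of the reversed step as
  soon as \<open>coeffA s c (1 - \<tau>) \<sigma> + coeffA s c \<tau> (1 - \<sigma>) = 1\<close>, which follows from
  \<open>lagrange s c i (1 - \<tau>) = lagrange s c (s + 1 - i) \<tau>\<close> and the fact that the Lagrange basis sums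
  to \<open>1\<close>.\<close>

section \<open>Exponentials of diagonal matrices\<close>

lemma matrix_power_diagonal:
  assumes "diagonal_matrix M"
  shows "matrix_power M k = (\<chi> i j. if i = j then (M $ i $ i) ^ k else 0)"
proof (induction k)
  case 0
  then show ?case by (simp add: mat_def vec_eq_iff)
next
  case (Suc k)
  have off: "M $ i $ l = 0" if "i \<noteq> l" for i l
    using assms that by (auto simp: diagonal_matrix_def)
  have "(\<Sum>l\<in>UNIV. M $ i $ l * (if l = j then (M $ l $ l) ^ k else 0))
      = (if i = j then (M $ i $ i) ^ Suc k else 0)" for i j
    by (auto simp: off if_distrib sum.delta cong: if_cong)
  then show ?case
    by (simp add: Suc matrix_matrix_mult_def vec_eq_iff)
qed

text \<open>All powers are diagonal, so the series converges entry by entry, each diagonal entry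
  being a scalar exponential series.\<close>

lemma matrix_exp_diagonal:
  assumes "diagonal_matrix M"
  shows "matrix_exp M = (\<chi> i j. if i = j then exp (M $ i $ i) else 0)"
proof -
  have entry: "(\<lambda>k. (1 / fact k) *\<^sub>R (if i = j then (M $ i $ i) ^ k else 0))
      sums (if i = j then exp (M $ i $ i) else 0)" for i j
    using exp_converges[of "M $ i $ i"] by (auto simp: divide_inverse)
  have "(\<lambda>k. (1 / fact k) *\<^sub>R matrix_power M k) sums
      (\<chi> i j. if i = j then exp (M $ i $ i) else 0)"
    unfolding sums_def
    by (intro vec_tendstoI) (use entry in \<open>simp add: matrix_power_diagonal[OF assms] sums_def\<close>)
  then show ?thesis
    by (simp add: matrix_exp_def sums_iff)
qed

lemma diagonal_matrix_uminus: "diagonal_matrix M \<Longrightarrow> diagonal_matrix (- M)"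
  by (simp add: diagonal_matrix_def)

lemma matrix_exp_mult_uminus_diagonal:
  assumes "diagonal_matrix M"
  shows "matrix_exp M ** matrix_exp (- M) = mat 1"
proof -
  \<comment> \<open>Only \<open>k = i\<close> contributes; there the diagonal entries
    \<open>exp m\<close> and \<open>exp (- m)\<close> cancel.\<close>
  have "(\<Sum>k\<in>UNIV. (if i = k then exp (M $ i $ i) else 0) * (if k = j then exp ((- M) $ k $ k) else 0))
      = (\<Sum>k\<in>UNIV. if i = k then (if i = j then 1 else 0) else (0::real))" for i j
    by (intro sum.cong) (auto simp: exp_minus)
  then show ?thesis
    by (simp add: matrix_exp_diagonal[OF assms] matrix_exp_diagonal[OF diagonal_matrix_uminus[OF assms]]
        matrix_matrix_mult_def vec_eq_iff mat_def)
qed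

text \<open>Allows an exponential factor to be moved across an equation; this is how the update
  formula is later solved for \<open>x0\<close>.\<close>

lemma matrix_exp_uminus_cancel_diagonal:
  assumes "diagonal_matrix M"
  shows "matrix_exp M *v (matrix_exp (- M) *v x) = x"
    and "matrix_exp (- M) *v (matrix_exp M *v x) = x"
  using matrix_exp_mult_uminus_diagonal[OF assms]
    matrix_exp_mult_uminus_diagonal[OF diagonal_matrix_uminus[OF assms]]
  by (simp_all add: matrix_vector_mul_assoc)

lemma continuous_on_matrix_exp_diagonal:
  assumes "continuous_on T M" and diag: "\<And>t. t \<in> T \<Longrightarrow> diagonal_matrix (M t)"
  shows "continuous_on T (\<lambda>t. matrix_exp (M t))"
proof -
  have "continuous_on T (\<lambda>t. \<chi> i j. if i = j then exp (M t $ i $ i) else 0)"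
  proof (intro continuous_on_vec_lambda)
    fix i j
    show "continuous_on T (\<lambda>t. if i = j then exp (M t $ i $ i) else 0)"
      by (cases "i = j") (auto intro!: continuous_intros assms(1))
  qed
  then show ?thesis
    by (subst continuous_on_cong[OF refl matrix_exp_diagonal[OF diag]]) auto
qed

lemma continuous_on_matrix_vector_mult:
  fixes A :: "'a::topological_space \<Rightarrow> real ^ 'm ^ 'n"
  assumes "continuous_on T A" "continuous_on T v"
  shows "continuous_on T (\<lambda>t. A t *v v t)"
  unfolding matrix_vector_mult_def by (intro continuous_intros assms)

section \<open>Interval integrals\<close>

text \<open>Substitution of \<open>r - x\<close>, whose Jacobian has modulus 1. The case
  \<open>a > b\<close> follows by swapping the end points on both sides.\<close>

lemma interval_integral_reflect_about:
  fixes f :: "real \<Rightarrow> 'a::euclidean_space" and a b r :: real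
  shows "(LBINT x=a..b. f x) = (LBINT x=r-b..r-a. f (r - x))"
proof -
  have le: "(LBINT x=a..b. f x) = (LBINT x=r-b..r-a. f (r - x))" if "a \<le> b" for a b :: real
  proof -
    have "indicator {a<..<b} (r - x) = (indicator {r-b<..<r-a} x :: real)" for x
      by (auto simp: indicator_def)
    then show ?thesis
      using that lborel_integral_real_affine[of "-1" "\<lambda>x. indicator {a<..<b} x *\<^sub>R f x" r]
      by (simp add: interval_lebesgue_integral_def set_lebesgue_integral_def)
  qed
  show ?thesis
  proof (cases "a \<le> b")
    case False
    then show ?thesis
      using le[of b a] interval_integral_endpoints_reverse[of "ereal a" "ereal b" f]
        interval_integral_endpoints_reverse[of "ereal (r - b)" "ereal (r - a)" "\<lambda>x. f (r - x)"]
      by simp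
  qed (rule le)
qed

text \<open>Reading off an entry is bounded linear and commutes with the integral; a non-integrable
  function has integral 0 by convention, which is diagonal too.\<close>

lemma diagonal_matrix_interval_integral:
  assumes "\<And>t. diagonal_matrix (D t)"
  shows "diagonal_matrix (LBINT t=a..b. D t)"
proof -
  \<comment> \<open>An arbitrary set \<open>T\<close> covers both orientations, where the integral
    is a set integral up to sign.\<close>
  have "(LBINT t:T. D t) $ i $ j = 0" if "i \<noteq> j" for T i j
  proof (cases "set_integrable lborel T D")
    case True
    have "bounded_linear (\<lambda>M::real ^ 'a ^ 'a. M $ i $ j)"
      by (rule bounded_linear_compose[OF bounded_linear_vec_nth bounded_linear_vec_nth])
    from integral_bounded_linear[OF this True[unfolded set_integrable_def]]
    show ?thesis
      using assms that by (simp add: set_lebesgue_integral_def diagonal_matrix_def)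
  next
    case False
    then show ?thesis
      by (simp add: set_lebesgue_integral_def set_integrable_def not_integrable_integral_eq)
  qed
  then show ?thesis
    by (simp add: diagonal_matrix_def interval_lebesgue_integral_def)
qed

lemma continuous_on_interval_integral:
  fixes f :: "real \<Rightarrow> 'a::euclidean_space" and a b r :: real
  assumes "continuous_on UNIV f"
  shows "continuous_on {a..b} (\<lambda>u. LBINT y=r..u. f y)"
proof -
  \<comment> \<open>The fundamental theorem needs the base point \<open>r\<close> inside the
    interval, so it is applied on the hull of \<open>r\<close> and \<open>{a..b}\<close>.\<close>
  have "((\<lambda>u. LBINT y=r..u. f y) has_vector_derivative f x)
      (at x within {min a r..max b r})" if "x \<in> {a..b}" for x
    using that
    by (intro interval_integral_FTC2 continuous_on_subset[OF assms]) auto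
  then have "((\<lambda>u. LBINT y=r..u. f y) has_vector_derivative f x)
      (at x within {a..b})" if "x \<in> {a..b}" for x
    by (rule has_vector_derivative_within_subset[OF _ _]) (use that in auto)
  then show ?thesis
    unfolding continuous_on_eq_continuous_within by (blast intro: has_vector_derivative_continuous)
qed

lemma damping_int_reverse: "damping_int D (t0 + h) (- h) = damping_int D t0 h"
  by (simp add: damping_int_def fun_eq_iff add.commute)

section \<open>Symmetry of the collocation coefficients\<close>

text \<open>Both sides are polynomials of degree below \<open>s\<close> that agree at the
  \<open>s\<close> distinct nodes.\<close>

lemma sum_lagrange:
  assumes "s \<ge> 1" "inj_on c {1..s}"
  shows "(\<Sum>i=1..s. lagrange s c i x) = 1"
proof -
  define p where "p i = (\<Prod>j\<in>{1..s} - {i}. smult (1 / (c i - c j)) [:- c j, 1:])" for i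
  have p: "poly (p i) y = lagrange s c i y" for i y
    by (simp add: p_def lagrange_def poly_prod algebra_simps diff_divide_distrib)
  have nodes: "lagrange s c i (c k) = (if i = k then 1 else 0)"
    if "i \<in> {1..s}" "k \<in> {1..s}" for i k
  proof (cases "i = k")
    case True
    have "(c i - c j) / (c i - c j) = 1" if "j \<in> {1..s} - {i}" for j
      using assms(2) that \<open>i \<in> {1..s}\<close> by (auto dest: inj_onD)
    then have "lagrange s c i (c i) = 1"
      unfolding lagrange_def by (intro prod.neutral) blast
    with True show ?thesis by simp
  next
    case False
    \<comment> \<open>The factor with \<open>j = k\<close> vanishes at \<open>c k\<close>.\<close>
    then show ?thesis
      using that by (auto simp: lagrange_def intro!: bexI[of _ k])
  qed
  have "(\<Sum>i=1..s. p i) = 1"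
  proof (rule poly_eqI_degree[where A = "c ` {1..s}"])
    show "poly (\<Sum>i=1..s. p i) y = poly 1 y" if y: "y \<in> c ` {1..s}" for y
    proof -
      obtain k where k: "k \<in> {1..s}" "y = c k" using y by blast
      have "poly (\<Sum>i=1..s. p i) y = (\<Sum>i=1..s. if i = k then 1 else 0)"
        using k by (simp add: poly_sum p nodes)
      then show ?thesis using k by simp
    qed
    have "degree (p i) \<le> s - 1" if i: "i \<in> {1..s}" for i
    proof -
      have "degree (smult (1 / (c i - c j)) [:- c j, 1:]) \<le> 1" for j
        by (rule order_trans[OF degree_smult_le]) simp
      then have "degree (p i) \<le> (\<Sum>j\<in>{1..s} - {i}. 1)"
        unfolding p_def by (intro order_trans[OF degree_prod_sum_le] sum_mono) auto
      then show ?thesis using i by simp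
    qed
    then have "degree (\<Sum>i=1..s. p i) \<le> s - 1"
      by (intro degree_sum_le) auto
    then show "degree (\<Sum>i=1..s. p i) < card (c ` {1..s})"
      using assms by (simp add: card_image)
    show "degree (1 :: real poly) < card (c ` {1..s})"
      using assms by (simp add: card_image)
  qed
  then show ?thesis
    using p by (metis (no_types, lifting) poly_1 poly_sum sum.cong)
qed

lemma continuous_on_lagrange [continuous_intros]: "continuous_on T (lagrange s c i)"
  unfolding lagrange_def divide_inverse by (intro continuous_intros)

lemma continuous_on_coeffA: "continuous_on T (coeffA s c \<tau>)"
  unfolding coeffA_def by (intro continuous_intros)

text \<open>The map \<open>j -> s + 1 - j\<close> permutes the factors, and in each of them
  numerator and denominator both change sign.\<close>

lemma lagrange_reflect:
  assumes sym: "\<And>i. i \<in> {1..s} \<Longrightarrow> c (s + 1 - i) = 1 - c i" and i: "i \<in> {1..s}"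
  shows "lagrange s c (s + 1 - i) (1 - x) = lagrange s c i x"
  unfolding lagrange_def
proof (rule prod.reindex_bij_witness[where i = "\<lambda>j. s + 1 - j" and j = "\<lambda>j. s + 1 - j"])
  fix j assume "j \<in> {1..s} - {s + 1 - i}"
  then have j: "j \<in> {1..s}" by auto
  have "(x - (1 - c j)) / (c i - (1 - c j)) = ((1 - x) - c j) / ((1 - c i) - c j)"
    using minus_divide_divide[of "x - (1 - c j)" "c i - (1 - c j)"] by (simp add: algebra_simps)
  then show "(x - c (s + 1 - j)) / (c i - c (s + 1 - j)) = (1 - x - c j) / (c (s + 1 - i) - c j)"
    by (simp only: sym[OF i] sym[OF j])
qed (use i in auto)

lemma weight_reflect:
  assumes "\<And>i. i \<in> {1..s} \<Longrightarrow> c (s + 1 - i) = 1 - c i" and "i \<in> {1..s}"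
  shows "weight s c (s + 1 - i) = weight s c i"
  using interval_integral_reflect_about[of 0 1 "lagrange s c (s + 1 - i)" 1]
  by (simp only: weight_def lagrange_reflect[of s c, OF assms]
      zero_ereal_def one_ereal_def diff_self diff_zero)

text \<open>Reflection turns the integral from 0 to \<open>\<tau>\<close> into the one from
  \<open>1 - \<tau>\<close> to 1, which complements the left-hand side to the full weight.\<close>

lemma interval_integral_lagrange_reflect:
  assumes "\<And>i. i \<in> {1..s} \<Longrightarrow> c (s + 1 - i) = 1 - c i" and "i \<in> {1..s}"
  shows "(LBINT \<alpha>=0..ereal (1 - \<tau>). lagrange s c i \<alpha>)
    = weight s c i - (LBINT \<alpha>=0..ereal \<tau>. lagrange s c (s + 1 - i) \<alpha>)"
proof -
  have i': "s + 1 - i \<in> {1..s}" "s + 1 - (s + 1 - i) = i" using assms(2) by auto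
  have "(LBINT \<alpha>=0..ereal \<tau>. lagrange s c (s + 1 - i) \<alpha>)
      = (LBINT \<alpha>=ereal (1 - \<tau>)..1. lagrange s c i \<alpha>)"
    using interval_integral_reflect_about[of 0 \<tau> "lagrange s c (s + 1 - i)" 1]
    by (simp only: lagrange_reflect[of s c, OF assms] zero_ereal_def one_ereal_def diff_zero)
  \<comment> \<open>Here \<open>\<tau>\<close> is any real, so \<open>1 - \<tau>\<close> may lie
    outside \<open>{0..1}\<close>; integrability is shown on the hull of all three end
    points.\<close>
  moreover have "interval_lebesgue_integrable lborel (min 0 (min (ereal (1 - \<tau>)) 1))
      (max 0 (max (ereal (1 - \<tau>)) 1)) (lagrange s c i)"
    using interval_integrable_continuous_on[OF _ continuous_on_lagrange,
        of "min 0 (min (1 - \<tau>) 1)" "max 0 (max (1 - \<tau>) 1)" s c i]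
    by (simp add: zero_ereal_def one_ereal_def flip: ereal_max ereal_min)
  from interval_integral_sum[OF this]
  have "(LBINT \<alpha>=0..ereal (1 - \<tau>). lagrange s c i \<alpha>)
      + (LBINT \<alpha>=ereal (1 - \<tau>)..1. lagrange s c i \<alpha>) = weight s c i"
    by (simp add: weight_def)
  ultimately show ?thesis by simp
qed

lemma coeffA_reflect:
  assumes "s \<ge> 1" "inj_on c {1..s}"
    and nz: "\<And>i. i \<in> {1..s} \<Longrightarrow> weight s c i \<noteq> 0"
    and sym: "\<And>i. i \<in> {1..s} \<Longrightarrow> c (s + 1 - i) = 1 - c i"
  shows "coeffA s c (1 - \<tau>) \<sigma> = 1 - coeffA s c \<tau> (1 - \<sigma>)"
proof -
  define I where "I i = (LBINT \<alpha>=0..ereal \<tau>. lagrange s c i \<alpha>)" for i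
  have "coeffA s c (1 - \<tau>) \<sigma>
      = (\<Sum>i=1..s. lagrange s c i \<sigma> - 1 / weight s c i * I (s + 1 - i) * lagrange s c i \<sigma>)"
    unfolding coeffA_def I_def
    \<comment> \<open>The full weight cancels against \<open>1 / weight s c i\<close>, leaving a
      bare basis polynomial; these sum to 1 in the next step.\<close>
    by (intro sum.cong refl)
      (simp add: interval_integral_lagrange_reflect[of s c, OF sym, simplified] nz field_simps)
  also have "\<dots> = 1 - (\<Sum>i=1..s. 1 / weight s c i * I (s + 1 - i) * lagrange s c i \<sigma>)"
    by (simp add: sum_subtractf sum_lagrange[OF assms(1,2), simplified])
  also have "(\<Sum>i=1..s. 1 / weight s c i * I (s + 1 - i) * lagrange s c i \<sigma>)
      = (\<Sum>i=1..s. 1 / weight s c i * I i * lagrange s c i (1 - \<sigma>))"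
  proof (rule sum.reindex_bij_witness[where i = "\<lambda>j. s + 1 - j" and j = "\<lambda>j. s + 1 - j"])
    fix i assume "i \<in> {1..s}"
    then show "1 / weight s c (s + 1 - i) * I (s + 1 - i) * lagrange s c (s + 1 - i) (1 - \<sigma>)
        = 1 / weight s c i * I (s + 1 - i) * lagrange s c i \<sigma>"
      by (simp only: lagrange_reflect[of s c, OF sym] weight_reflect[of s c, OF sym])
  qed auto
  finally show ?thesis by (simp add: coeffA_def I_def)
qed

section \<open>Reversing a step\<close>

text \<open>One implication suffices for the equivalence, because reversing a step twice gives back
  the original step.\<close>

lemma eepc_step_reverse:
  fixes S :: "real ^ 'n \<Rightarrow> real ^ 'n ^ 'n"
  assumes S: "continuous_on UNIV S"
    and H: "continuous_on UNIV (gradient H)"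
    and diag: "\<And>t. diagonal_matrix (D t)" and D: "continuous_on UNIV D"
    and nodes: "s \<ge> 1" "inj_on c {1..s}" "\<And>i. i \<in> {1..s} \<Longrightarrow> weight s c i \<noteq> 0"
      "\<And>i. i \<in> {1..s} \<Longrightarrow> c (s + 1 - i) = 1 - c i"
    and step: "eepc_step S H D s c t0 h x0 x1"
  shows "eepc_step S H D s c (t0 + h) (- h) x1 x0"
proof -
  define f where "f x = S x *v gradient H x" for x
  define Y where "Y \<tau> = damping_int D t0 h (t0 + \<tau> * h)" for \<tau>
  obtain X where contX: "continuous_on {0..1} X"
    and X: "\<And>\<tau>. \<tau> \<in> {0..1} \<Longrightarrow> X \<tau> = matrix_exp (- Y \<tau>) *v (matrix_exp (Y 0) *v x0 +
      h *\<^sub>R (LBINT \<sigma>=0..1. coeffA s c \<tau> \<sigma> *\<^sub>R f (matrix_exp (Y \<sigma>) *v X \<sigma>)))"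
    and x1: "x1 = matrix_exp (- Y 1) *v (matrix_exp (Y 0) *v x0 +
      h *\<^sub>R (LBINT \<sigma>=0..1. f (matrix_exp (Y \<sigma>) *v X \<sigma>)))"
    using step unfolding eepc_step_def Let_def f_def Y_def by blast
  define g where "g \<sigma> = f (matrix_exp (Y \<sigma>) *v X \<sigma>)" for \<sigma>
  have Y_diag: "diagonal_matrix (Y \<tau>)" for \<tau>
    unfolding Y_def damping_int_def by (rule diagonal_matrix_interval_integral[OF diag])
  have contY: "continuous_on {0..1} Y"
  proof -
    \<comment> \<open>The sign of \<open>h\<close> is arbitrary, so a compact interval around
      \<open>t0\<close> is chosen that contains the step in either direction.\<close>
    have "t0 + \<tau> * h \<in> {t0 - \<bar>h\<bar>..t0 + \<bar>h\<bar>}" if "\<tau> \<in> {0..1}" for \<tau>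
    proof -
      have "\<bar>\<tau> * h\<bar> \<le> \<bar>h\<bar>"
        using that by (simp add: abs_mult mult_left_le_one_le)
      then show ?thesis by auto
    qed
    then show ?thesis
      unfolding Y_def damping_int_def
      by (intro continuous_on_compose2[OF continuous_on_interval_integral[OF D,
          of "t0 - \<bar>h\<bar>" "t0 + \<bar>h\<bar>"]])
        (auto intro!: continuous_intros)
  qed
  have "continuous_on UNIV f"
    unfolding f_def by (intro continuous_on_matrix_vector_mult S H)
  then have contg: "continuous_on {0..1} g"
    unfolding g_def
    by (rule continuous_on_compose2)
      (auto intro!: continuous_on_matrix_vector_mult continuous_on_matrix_exp_diagonal contX contY Y_diag)
  \<comment> \<open>Needed to split the integral of a difference when the reflected coefficients are
    inserted.\<close>
  have integrable: "interval_lebesgue_integrable lborel 0 1 g"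
    "interval_lebesgue_integrable lborel 0 1 (\<lambda>\<sigma>. coeffA s c \<tau> (1 - \<sigma>) *\<^sub>R g \<sigma>)" for \<tau>
  proof -
    have "continuous_on {0..1} (\<lambda>\<sigma>. coeffA s c \<tau> (1 - \<sigma>))"
      by (rule continuous_on_compose2[OF continuous_on_coeffA[of UNIV]]) (auto intro!: continuous_intros)
    then have "continuous_on {0..1} (\<lambda>\<sigma>. coeffA s c \<tau> (1 - \<sigma>) *\<^sub>R g \<sigma>)"
      by (intro continuous_on_scaleR contg)
    from interval_integrable_continuous_on[OF _ this] interval_integrable_continuous_on[OF _ contg]
    show "interval_lebesgue_integrable lborel 0 1 g"
      "interval_lebesgue_integrable lborel 0 1 (\<lambda>\<sigma>. coeffA s c \<tau> (1 - \<sigma>) *\<^sub>R g \<sigma>)"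
      by (simp_all add: zero_ereal_def one_ereal_def)
  qed
  have reflect: "(LBINT \<sigma>=0..1. F \<sigma>) = (LBINT \<sigma>=0..1. F (1 - \<sigma>))" for F :: "real \<Rightarrow> real ^ 'n"
    using interval_integral_reflect_about[of 0 1 F 1] by (simp add: zero_ereal_def one_ereal_def)
  \<comment> \<open>The update formula freed of its outer exponential. It replaces the initial term
    of the reversed step by that of the forward step plus the full integral of
    \<open>g\<close>.\<close>
  have eY1: "matrix_exp (Y 1) *v x1 = matrix_exp (Y 0) *v x0 + h *\<^sub>R (LBINT \<sigma>=0..1. g \<sigma>)"
    by (simp add: x1 matrix_exp_uminus_cancel_diagonal[OF Y_diag] g_def)
  have stages: "X (1 - \<tau>) = matrix_exp (- Y (1 - \<tau>)) *v (matrix_exp (Y 1) *v x1 +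
      (- h) *\<^sub>R (LBINT \<sigma>=0..1. coeffA s c \<tau> \<sigma> *\<^sub>R g (1 - \<sigma>)))" if "\<tau> \<in> {0..1}" for \<tau>
  proof -
    have "(LBINT \<sigma>=0..1. coeffA s c (1 - \<tau>) \<sigma> *\<^sub>R g \<sigma>)
        = (LBINT \<sigma>=0..1. g \<sigma> - coeffA s c \<tau> (1 - \<sigma>) *\<^sub>R g \<sigma>)"
      by (simp only: coeffA_reflect[OF nodes] scaleR_diff_left scaleR_one)
    also have "\<dots> = (LBINT \<sigma>=0..1. g \<sigma>) - (LBINT \<sigma>=0..1. coeffA s c \<tau> (1 - \<sigma>) *\<^sub>R g \<sigma>)"
      by (intro interval_lebesgue_integral_diff integrable)
    also have "(LBINT \<sigma>=0..1. coeffA s c \<tau> (1 - \<sigma>) *\<^sub>R g \<sigma>)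
        = (LBINT \<sigma>=0..1. coeffA s c \<tau> \<sigma> *\<^sub>R g (1 - \<sigma>))"
      by (subst reflect) simp
    finally show ?thesis
      using X[of "1 - \<tau>"] that unfolding g_def[symmetric] eY1
      by (simp add: scaleR_diff_right add_diff_eq)
  qed
  \<comment> \<open>After \<open>eY1\<close> the two integrals of \<open>g\<close> cancel, since
    reflection makes them equal.\<close>
  have final: "x0 = matrix_exp (- Y 0) *v (matrix_exp (Y 1) *v x1 +
      (- h) *\<^sub>R (LBINT \<sigma>=0..1. g (1 - \<sigma>)))"
    unfolding eY1 reflect[of g, symmetric]
    by (simp add: matrix_exp_uminus_cancel_diagonal[OF Y_diag])
  \<comment> \<open>The reversed step reaches at \<open>\<tau>\<close> the time that the forward
    step reaches at \<open>1 - \<tau>\<close>; so its initial exponent is \<open>Y 1\<close> and its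
    final one \<open>Y 0\<close>.\<close>
  have Y_rev: "damping_int D (t0 + h) (- h) (t0 + h + \<tau> * - h) = Y (1 - \<tau>)" for \<tau>
    unfolding damping_int_reverse Y_def by (simp add: algebra_simps)
  have "continuous_on {0..1} (\<lambda>\<tau>. X (1 - \<tau>))"
    by (rule continuous_on_compose2[OF contX]) (auto intro!: continuous_intros)
  then show ?thesis
    unfolding eepc_step_def Let_def Y_rev f_def[symmetric]
    using stages final by (intro exI[of _ "\<lambda>\<tau>. X (1 - \<tau>)"]) (simp add: g_def)
qed

theorem theorem2:
  fixes S :: "real ^ 'n \<Rightarrow> real ^ 'n ^ 'n"
    and H :: "real ^ 'n \<Rightarrow> real"
    and D :: "real \<Rightarrow> real ^ 'n ^ 'n"
    and s :: nat and c :: "nat \<Rightarrow> real"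
  assumes "\<And>x. skew_symmetric (S x)"
    and "continuous_on UNIV S"
    and "continuously_differentiable H"
    and "\<And>t. diagonal_matrix (D t)"
    and "continuous_on UNIV D"
    and "s \<ge> 1"
    and "inj_on c {1..s}"
    and "\<And>i. i \<in> {1..s} \<Longrightarrow> weight s c i \<noteq> 0"
    and "\<And>i. i \<in> {1..s} \<Longrightarrow> c (s + 1 - i) = 1 - c i"
  shows "symmetric_method (eepc_step S H D s c)"
proof -
  have "continuous_on UNIV (gradient H)"
    using assms(3) by (simp add: continuously_differentiable_def)
  note reverse = eepc_step_reverse[OF assms(2) this assms(4-9)]
  have "eepc_step S H D s c t0 h x0 x1 \<longleftrightarrow> eepc_step S H D s c (t0 + h) (- h) x1 x0" for t0 h x0 x1
    \<comment> \<open>The second instance starts at \<open>t0 + h\<close> with step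
      \<open>- h\<close>, and its conclusion simplifies back to \<open>t0\<close> and
      \<open>h\<close>.\<close>
    using reverse[of t0 h x0 x1] reverse[of "t0 + h" "- h" x1 x0] by auto
  then show ?thesis
    by (simp add: symmetric_method_def)
qed

end
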